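(* Let $P_0$ and $P$ be arbitrary probability measures on a measurable space, with densities $p_0$ and $p$ with respect to a common $\sigma$-finite dominating measure, and let $\delta\in(0,1]$. Then \[ \Bigl(1-\frac{1}{4^\delta}\Bigr)^2 P_0\Bigl(\Bigl[\frac{p_0}{p}\Bigr]^\delta\mathbf{1}\Bigl\{\frac{p_0}{p}>4\Bigr\}\Bigr)\leq\Bigl\|\delta\log\frac{p_0}{p}\Bigr\|_{P_0,B}^2\leq 18\,\delta\, h(p_0,p)^2+2P_0\Bigl(\Bigl[\frac{p_0}{p}\Bigr]^\delta\mathbf{1}\Bigl\{\frac{p_0}{p}>4\Bigr\}\Bigr). \] Moreover: (i) $h(p_0,p)^2\leq K(p_0\,\Vert\, p)\leq 3h(p_0,p)^2+\delta^{-1}P_0\bigl(\bigl[\frac{p_0}{p}\bigr]^\delta\mathbf{1}\{\frac{p_0}{p}>4\}\bigr)$; (ii) for every real $k\geq 2$, $2^{-k}V_{k,0}(p_0\,\Vert\, p)\leq V_k(p_0\,\Vert\, p)\leq 2^{-1}\Gamma(k+1)\,\delta^{-k}\,\bigl\|\delta\log\frac{p_0}{p}\bigr\|_{P_0,B}^2$.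
   Context: For a probability measure $P$ and measurable $f$, $Pf=P(f)=\int f\,dP$ denotes expectation. Densities are taken with respect to any $\sigma$-finite measure $\mu$ dominating both measures; the Hellinger distance, the Kullback--Leibler divergence and variations, the Bernstein ``norm'', and $P_0([p_0/p]^\delta\mathbf 1\{p_0/p>4\})$ do not depend on the choice of $\mu$. Hellinger distance: $h(p,q)=\bigl[\int(\sqrt p-\sqrt q)^2\,d\mu\bigr]^{1/2}$ (no factor $1/2$). Kullback--Leibler divergence: $K(p\,\Vert\, q)=P\log\frac pq$. For $k>1$, the $k$th order Kullback--Leibler variation is $V_k(p\,\Vert\, q)=P\bigl|\log\frac pq\bigr|^k$ and the centered one is $V_{k,0}(p\,\Vert\, q)=P\bigl|\log\frac pq-K(p\,\Vert\, q)\bigr|^k$. Bernstein ``norm'' of a measurable function $f$: $\|f\|_{P,B}=\sqrt{2P(e^{|f|}-1-|f|)}$. Conventions: all quantities take values in $[0,\infty]$. Events of $P_0$-probability zero (such as $\{p_0=0\}$) are ignored in $P_0$-integrals. Where $p_0>0$ and $p=0$, the ratio $p_0/p$ and its logarithm are $+\infty$, so if this set has positive $P_0$-probability, each of $K(p_0\,\Vert\, p)$, $V_k(p_0\,\Vert\, p)$, $V_{k,0}(p_0\,\Vert\, p)$, the Bernstein ``norm'' $\|\delta\log\frac{p_0}{p}\|_{P_0,B}$, and $P_0([p_0/p]^\delta\mathbf 1\{p_0/p>4\})$ is understood to be $+\infty$. $V_{k,0}(p_0\,\Vert\, p)$ is likewise read as $+\infty$ when $K(p_0\,\Vert\, p)=+\infty$.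 $\Gamma$ is the gamma function. *)

theory Defs
  imports "HOL-Probability.Probability"
begin

text \<open>
  All functionals below are computed with extended-valued integrands, so that a set
  \<open>{p > 0, q = 0}\<close> of positive \<open>P\<close>-probability makes the integrals infinite. The real function
  \<open>powr\<close> is extended by \<open>\<infinity> powr a = \<infinity>\<close>; it is used only for exponents \<open>a > 0\<close>.
\<close>

definition epowr :: "ennreal \<Rightarrow> real \<Rightarrow> ennreal" where
  "epowr x a = (if x = \<infinity> then \<infinity> else ennreal (enn2real x powr a))"

definition elog :: "ennreal \<Rightarrow> ereal" where
  "elog x = (if x = \<infinity> then \<infinity> else if x = 0 then - \<infinity> else ereal (ln (enn2real x)))"

text \<open>In \<^typ>\<open>ennreal\<close> the quotient \<open>a / 0\<close> is \<open>\<infinity>\<close> for \<open>a > 0\<close>. The value \<open>0 / 0 = 0\<close> occurs only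
  where \<open>p = 0\<close>, a null set of the measure with density \<open>p\<close>.\<close>

definition ratio :: "('a \<Rightarrow> real) \<Rightarrow> ('a \<Rightarrow> real) \<Rightarrow> 'a \<Rightarrow> ennreal" where
  "ratio p q x = ennreal (p x) / ennreal (q x)"

definition log_ratio :: "('a \<Rightarrow> real) \<Rightarrow> ('a \<Rightarrow> real) \<Rightarrow> 'a \<Rightarrow> ereal" where
  "log_ratio p q x = elog (ratio p q x)"

definition hellinger :: "'a measure \<Rightarrow> ('a \<Rightarrow> real) \<Rightarrow> ('a \<Rightarrow> real) \<Rightarrow> ennreal" where
  "hellinger M p q = epowr (\<integral>\<^sup>+x. ennreal ((sqrt (p x) - sqrt (q x))\<^sup>2) \<partial>M) (1/2)"

text \<open>
  The integral of an extended-real function, as positive part minus negative part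
  (\<^const>\<open>e2ennreal\<close> truncates at 0). For \<^term>\<open>log_ratio p q\<close> and probability densities the negative
  part always has a finite integral, so the difference is never \<open>\<infinity> - \<infinity>\<close>. The library's
  \<^const>\<open>KL_divergence\<close> is a real-valued Bochner integral and is 0 where the divergence is infinite.
\<close>

definition expect :: "'a measure \<Rightarrow> ('a \<Rightarrow> ereal) \<Rightarrow> ereal" where
  "expect P f = enn2ereal (\<integral>\<^sup>+x. e2ennreal (f x) \<partial>P) - enn2ereal (\<integral>\<^sup>+x. e2ennreal (- f x) \<partial>P)"

definition KL :: "'a measure \<Rightarrow> ('a \<Rightarrow> real) \<Rightarrow> ('a \<Rightarrow> real) \<Rightarrow> ereal" where
  "KL M p q = expect (density M p) (log_ratio p q)"

definition KL_variation :: "real \<Rightarrow> 'a measure \<Rightarrow> ('a \<Rightarrow> real) \<Rightarrow> ('a \<Rightarrow> real) \<Rightarrow> ennreal" where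
  "KL_variation k M p q = (\<integral>\<^sup>+x. epowr (e2ennreal \<bar>log_ratio p q x\<bar>) k \<partial>density M p)"

definition KL_variation_centered :: "real \<Rightarrow> 'a measure \<Rightarrow> ('a \<Rightarrow> real) \<Rightarrow> ('a \<Rightarrow> real) \<Rightarrow> ennreal" where
  "KL_variation_centered k M p q =
     (if KL M p q = \<infinity> then \<infinity>
      else (\<integral>\<^sup>+x. epowr (e2ennreal \<bar>log_ratio p q x - KL M p q\<bar>) k \<partial>density M p))"

text \<open>The extension of \<open>y \<mapsto> exp y - 1 - y\<close> to \<open>[0, \<infinity>]\<close>.\<close>

definition bernstein_fun :: "ereal \<Rightarrow> ennreal" where
  "bernstein_fun y = (if y = \<infinity> then \<infinity> else ennreal (exp (real_of_ereal y) - 1 - real_of_ereal y))"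

definition bernstein_norm :: "'a measure \<Rightarrow> ('a \<Rightarrow> ereal) \<Rightarrow> ennreal" where
  "bernstein_norm P f = epowr (2 * (\<integral>\<^sup>+x. bernstein_fun \<bar>f x\<bar> \<partial>P)) (1/2)"

definition ratio_tail :: "real \<Rightarrow> 'a measure \<Rightarrow> ('a \<Rightarrow> real) \<Rightarrow> ('a \<Rightarrow> real) \<Rightarrow> ennreal" where
  "ratio_tail \<delta> M p q =
     (\<integral>\<^sup>+x. epowr (ratio p q x) \<delta> * indicator {y. ratio p q y > 4} x \<partial>density M p)"

end

theory Submission
  imports Defs
begin

text \<open>
  Write \<open>r = p\<^sub>0/p\<close> and \<open>s = sqrt (p/p\<^sub>0)\<close>. All inequalities come from pointwise
  ones, integrated against \<open>P\<^sub>0\<close>, using \<open>P\<^sub>0 (1 - s)\<^sup>2 \<le> h\<^sup>2\<close> and \<open>2 P\<^sub>0 (1 - s) = h\<^sup>2\<close>.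
  On \<open>r \<le> 4\<close>, that is \<open>s \<ge> 1/2\<close>, the functions \<open>exp \<bar>log r\<bar> - 1 - \<bar>log r\<bar>\<close> and \<open>log r - 2 (1 - s)\<close>
  are at most \<open>9 (1 - s)\<^sup>2\<close> and \<open>2 (1 - s)\<^sup>2\<close>, and convexity of \<open>exp\<close> gives the factor \<open>\<delta>\<close>; on \<open>r > 4\<close>,
  \<open>exp \<bar>\<delta> log r\<bar> = r\<^sup>\<delta>\<close> and \<open>\<delta> log r \<le> r\<^sup>\<delta>\<close>. The bound on the variations is
  \<open>u\<^sup>k \<le> \<Gamma>(k + 1) (exp u - 1 - u)\<close> at \<open>u = \<delta> \<bar>log r\<bar>\<close>.
  If \<open>{p = 0}\<close> has positive \<open>P\<^sub>0\<close>-probability, every quantity except \<open>h\<close> is infinite; otherwise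
  \<open>r\<close> may be treated as a positive real.
\<close>

subsection \<open>Inequalities for real numbers\<close>

text \<open>The two sides agree at \<open>t = 1\<close>, and their difference has the perfect square
  \<open>(1 - 1/t)^2\<close> as derivative.\<close>

lemma two_ln_le_diff_inverse:
  fixes t :: real
  assumes "1 \<le> t"
  shows "2 * ln t \<le> t - 1 / t"
proof -
  have "(\<lambda>t. t - 1 / t - 2 * ln t) 1 \<le> (\<lambda>t. t - 1 / t - 2 * ln t) t"
  proof (rule DERIV_nonneg_imp_nondecreasing[OF assms])
    fix x :: real
    assume x: "1 \<le> x"
    have "((\<lambda>t. t - 1 / t - 2 * ln t) has_real_derivative (1 - 1 / x)\<^sup>2) (at x)"
      using x by (auto intro!: derivative_eq_intros simp: power2_eq_square field_simps)
    then show "\<exists>y. ((\<lambda>t. t - 1 / t - 2 * ln t) has_real_derivative y) (at x) \<and> 0 \<le> y"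
      by (meson zero_le_power2)
  qed
  then show ?thesis by simp
qed

text \<open>Since \<open>1 - 1/t\<close> increases, \<open>c\<close> may be replaced by
  \<open>t\<close>. Then \<open>(1 - 1/t)^2 * t = t - 2 + 1/t\<close>, and what remains is exactly
  \<open>two_ln_le_diff_inverse\<close>. The intended values are \<open>c = 4 powr \<delta>\<close>
  and \<open>t = r powr \<delta>\<close>.\<close>

lemma bernstein_fun_lower_bound:
  fixes c t :: real
  assumes "1 \<le> c" "c \<le> t"
  shows "(1 - 1 / c)\<^sup>2 * t \<le> 2 * (t - 1 - ln t)"
proof -
  have "(1 - 1 / c)\<^sup>2 * t \<le> (1 - 1 / t)\<^sup>2 * t"
    using assms by (intro mult_right_mono power_mono) (auto simp: frac_le)
  also have "\<dots> = t - 2 + 1 / t"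
    using assms by (simp add: power2_eq_square field_simps)
  also have "\<dots> \<le> 2 * (t - 1 - ln t)"
    using two_ln_le_diff_inverse[of t] assms by simp
  finally show ?thesis .
qed

lemma exp_scale_le:
  fixes d y :: real
  assumes "0 \<le> d" "d \<le> 1"
  shows "exp (d * y) - 1 - d * y \<le> d * (exp y - 1 - y)"
  using convex_onD[OF exp_convex, of d 0 y] assms by (simp add: algebra_simps)

text \<open>The absolute value changes form at \<open>s = 1\<close>. On each side
  \<open>ln y <= y - 1\<close> lets \<open>(1 - s)^2\<close> be factored out; the cofactor is
  \<open>1 + 2/s <= 3\<close> above 1, and \<open>(1 + 2*s)/s^2\<close> below 1, where it is at most
  8, its value at \<open>s = 1/2\<close>. So 9 leaves some slack.\<close>

lemma exp_abs_two_ln_le: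
  fixes s :: real
  assumes "1 / 2 \<le> s"
  shows "exp \<bar>2 * ln s\<bar> - 1 - \<bar>2 * ln s\<bar> \<le> 9 * (1 - s)\<^sup>2"
proof (cases "1 \<le> s")
  case True
  have "exp (2 * ln s) = s\<^sup>2"
    using True by (simp add: exp_double)
  then have "exp \<bar>2 * ln s\<bar> - 1 - \<bar>2 * ln s\<bar> = s\<^sup>2 - 1 - 2 * ln s"
    using True by simp
  also have "\<dots> \<le> s\<^sup>2 - 1 - 2 * (1 - 1 / s)"
    using ln_le_minus_one[of "1 / s"] True by (simp add: ln_div)
  also have "\<dots> = (1 - s)\<^sup>2 * (1 + 2 / s)"
    using True by (simp add: power2_eq_square field_simps)
  also have "\<dots> \<le> (1 - s)\<^sup>2 * 9"
    using True by (intro mult_left_mono) (auto simp: field_simps)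
  finally show ?thesis by simp
next
  case False
  have "exp (- (2 * ln s)) = 1 / s\<^sup>2"
    using assms by (simp add: exp_minus exp_double inverse_eq_divide)
  then have "exp \<bar>2 * ln s\<bar> - 1 - \<bar>2 * ln s\<bar> = 1 / s\<^sup>2 - 1 + 2 * ln s"
    using False assms by (simp add: abs_if)
  also have "\<dots> \<le> 1 / s\<^sup>2 - 1 + 2 * (s - 1)"
    using ln_le_minus_one[of s] assms by simp
  also have "\<dots> = (1 - s)\<^sup>2 * ((1 + 2 * s) / s\<^sup>2)"
    using assms by (simp add: power2_eq_square field_simps)
  also have "\<dots> \<le> (1 - s)\<^sup>2 * 9"
  proof (intro mult_left_mono)
    \<comment> \<open>The polynomial \<open>9*s^2 - 2*s - 1\<close> equals 1/4 at
      \<open>s = 1/2\<close>; subtracting this value makes \<open>s - 1/2\<close> a factor.\<close>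
    have "0 \<le> (s - 1 / 2) * (9 * s + 5 / 2)"
      using assms by (intro mult_nonneg_nonneg) auto
    also have "\<dots> = 9 * s\<^sup>2 - 2 * s - 5 / 4"
      by (simp add: power2_eq_square field_simps)
    finally have "1 + 2 * s \<le> 9 * s\<^sup>2" by simp
    then show "(1 + 2 * s) / s\<^sup>2 \<le> 9"
      using assms by (simp add: divide_le_eq)
  qed simp
  finally show ?thesis by simp
qed

text \<open>The derivative of \<open>\<phi>\<close> has its zeros at 1/2 and 1, so
  \<open>\<phi>\<close> decreases on [1/2, 1] and increases afterwards, with minimum
  \<open>\<phi> 1 = 0\<close>. The threshold \<open>r <= 4\<close>, that is \<open>s >= 1/2\<close>,
  is just what this argument requires.\<close>

lemma minus_ln_le_quadratic:
  fixes s :: real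
  assumes "1 / 2 \<le> s"
  shows "- ln s \<le> (1 - s) + (1 - s)\<^sup>2"
proof -
  define \<phi> :: "real \<Rightarrow> real" where "\<phi> = (\<lambda>s. (1 - s) + (1 - s)\<^sup>2 + ln s)"
  have deriv: "(\<phi> has_real_derivative (1 - x) * (1 - 2 * x) / x) (at x)" if "0 < x" for x
    unfolding \<phi>_def using that
    by (auto intro!: derivative_eq_intros simp: power2_eq_square field_simps)
  have "\<phi> 1 \<le> \<phi> s"
  proof (cases "1 \<le> s")
    case True
    show ?thesis
    proof (rule DERIV_nonneg_imp_nondecreasing[OF True])
      fix x :: real
      assume x: "1 \<le> x"
      then have "0 \<le> (1 - x) * (1 - 2 * x) / x"
        by (intro divide_nonneg_nonneg mult_nonpos_nonpos) auto
      then show "\<exists>y. (\<phi> has_real_derivative y) (at x) \<and> 0 \<le> y"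
        using deriv[of x] x by auto
    qed
  next
    case False
    then have "s \<le> 1" by simp
    then show ?thesis
    proof (rule DERIV_nonpos_imp_nonincreasing)
      fix x :: real
      assume x: "s \<le> x" "x \<le> 1"
      then have "(1 - x) * (1 - 2 * x) / x \<le> 0"
        using assms by (intro divide_nonpos_nonneg mult_nonneg_nonpos) auto
      then show "\<exists>y. (\<phi> has_real_derivative y) (at x) \<and> y \<le> 0"
        using deriv[of x] x assms by auto
    qed
  qed
  then show ?thesis by (simp add: \<phi>_def)
qed

section \<open>Powers, the Gamma function and the exponential series\<close>

lemma powr_above_tangent:
  fixes a c k :: real
  assumes "0 \<le> a" "0 < c" "1 \<le> k"
  shows "c powr k + k * c powr (k - 1) * (a - c) \<le> a powr k"
proof (cases "a = 0")
  case True
  \<comment> \<open>At \<open>a = 0\<close> the claim is \<open>c powr k <= k * c powr k\<close>. It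
    is treated apart because the tangent argument below runs on the open half-line.\<close>
  have "c powr k \<le> k * c powr k"
    using assms by simp
  also have "\<dots> = k * c powr (k - 1) * c"
    using assms by (simp add: powr_diff)
  finally show ?thesis using True by simp
next
  case False
  have "((\<lambda>x. x powr k) has_real_derivative k * c powr (k - 1)) (at c within {0<..})"
    by (rule has_field_derivative_at_within[OF has_real_derivative_powr[OF assms(2)]])
  then have "(k * c powr (k - 1)) * (a - c) \<le> a powr k - c powr k"
    using assms False
    by (intro convex_on_imp_above_tangent[OF powr_convex[OF assms(3)], of c a])
       (simp_all add: interior_open)
  then show ?thesis by simp
qed

text \<open>Convexity at the midpoint \<open>c\<close>: in the sum of the tangent inequalities for
  \<open>a\<close> and \<open>b\<close> the linear terms cancel, because
  \<open>a - c = -(b - c)\<close>.\<close>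

lemma add_powr_le:
  fixes a b k :: real
  assumes "0 \<le> a" "0 \<le> b" "1 \<le> k"
  shows "(a + b) powr k \<le> 2 powr (k - 1) * (a powr k + b powr k)"
proof (cases "a + b = 0")
  case False
  define c where "c = (a + b) / 2"
  have c: "0 < c" using False assms by (simp add: c_def)
  have "k * c powr (k - 1) * (b - c) = - (k * c powr (k - 1) * (a - c))"
    by (simp add: c_def field_simps)
  then have "2 * c powr k \<le> a powr k + b powr k"
    using powr_above_tangent[OF assms(1) c assms(3)] powr_above_tangent[OF assms(2) c assms(3)]
    by linarith
  then have "2 powr (k - 1) * (2 * c powr k) \<le> 2 powr (k - 1) * (a powr k + b powr k)"
    by (intro mult_left_mono) auto
  moreover have "2 powr (k - 1) * (2 * c powr k) = (2 * c) powr k"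
    using c by (simp add: powr_diff powr_mult)
  moreover have "2 * c = a + b" by (simp add: c_def)
  ultimately show ?thesis by simp
qed (use assms in simp)

text \<open>With \<open>x = n + \<theta> + 1\<close>, the point \<open>n + 2\<close> is the convex
  combination of \<open>x\<close> and \<open>x + 1\<close> with weights \<open>\<theta>\<close> and
  \<open>1 - \<theta>\<close>. Log-convexity of Gamma there, with
  \<open>Gamma (x + 1) = x * Gamma x\<close>, gives the bound.\<close>

lemma fact_le_Gamma_times_powr:
  fixes \<theta> :: real and n :: nat
  assumes "0 \<le> \<theta>" "\<theta> \<le> 1"
  shows "fact (Suc n) \<le> Gamma (n + \<theta> + 1) * (n + \<theta> + 1) powr (1 - \<theta>)"
proof -
  define x where "x = n + \<theta> + 1"
  have x: "0 < x" using assms by (simp add: x_def add_nonneg_pos)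
  have G: "0 < Gamma x" using x by (rule Gamma_real_pos)
  have Gx: "ln (Gamma (x + 1)) = ln x + ln (Gamma x)"
  proof -
    have "x \<notin> \<int>\<^sub>\<le>\<^sub>0" using x by (auto elim!: nonpos_Ints_cases')
    then have "Gamma (x + 1) = x * Gamma x" by (rule Gamma_plus1)
    then show ?thesis using ln_mult_pos[OF x G] by simp
  qed
  have "\<theta> * x + (1 - \<theta>) * (x + 1) = real (Suc n) + 1"
    by (simp add: x_def algebra_simps)
  then have "Gamma (\<theta> * x + (1 - \<theta>) * (x + 1)) = fact (Suc n)"
    using Gamma_fact[of "Suc n", where 'a = real] by (simp add: add_ac)
  moreover have "(ln \<circ> Gamma) (\<theta> * x + (1 - \<theta>) * (x + 1))
      \<le> \<theta> * (ln \<circ> Gamma) x + (1 - \<theta>) * (ln \<circ> Gamma) (x + 1)"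
    using convex_onD[OF log_convex_Gamma_real, of "1 - \<theta>" x "x + 1"] assms x by simp
  ultimately have "ln (fact (Suc n)) \<le> ln (Gamma x) + (1 - \<theta>) * ln x"
    unfolding o_def Gx by (simp add: algebra_simps del: fact_Suc)
  also have "\<dots> = ln (Gamma x * x powr (1 - \<theta>))"
    using x G by (subst ln_mult_pos) (auto simp: ln_powr)
  finally show ?thesis
    using x G unfolding x_def[symmetric] by (subst (asm) ln_le_cancel_iff) auto
qed

text \<open>All terms of the exponential series are nonnegative, so any finite selection is at most
  the sum; \<open>2 <= n\<close> keeps the selected terms distinct from those of index 0 and
  1.\<close>

lemma two_exp_terms_le:
  fixes u :: real and n :: nat
  assumes "0 \<le> u" "2 \<le> n"
  shows "u ^ n / fact n + u ^ Suc n / fact (Suc n) \<le> exp u - 1 - u"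
proof -
  have "(\<Sum>i\<in>{0, 1, n, Suc n}. u ^ i / fact i) \<le> exp u"
  proof -
    have "(\<Sum>i\<in>{0, 1, n, Suc n}. u ^ i / fact i) \<le> (\<Sum>i. u ^ i / fact i)"
      using summable_exp_generic[of u] assms
      by (intro sum_le_suminf) (auto simp: divide_inverse mult.commute)
    then show ?thesis by (simp add: exp_def divide_inverse mult.commute)
  qed
  then show ?thesis using assms by simp
qed

text \<open>Writing \<open>k = n + \<theta>\<close>, log-convexity of the Gamma function and the weighted AM-GM inequality
  bound \<open>u\<^sup>k / \<Gamma>(k + 1)\<close> by the sum of its values at the integers \<open>n\<close> and \<open>n + 1\<close>.\<close>

lemma powr_le_Gamma_times_exp:
  fixes u k :: real
  assumes "0 \<le> u" "2 \<le> k"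
  shows "u powr k \<le> Gamma (k + 1) * (exp u - 1 - u)"
proof (cases "u = 0")
  case False
  then have u: "0 < u" using assms by simp
  define n where "n = nat \<lfloor>k\<rfloor>"
  define \<theta> where "\<theta> = k - n"
  have n: "2 \<le> n" using assms unfolding n_def by linarith
  have \<theta>: "0 \<le> \<theta>" "\<theta> \<le> 1" using assms unfolding \<theta>_def n_def by linarith+
  have k: "k = n + \<theta>" by (simp add: \<theta>_def)
  have G: "0 < Gamma (k + 1)" using assms by (intro Gamma_real_pos) auto
  have "u powr \<theta> * (n + \<theta> + 1) powr (1 - \<theta>) \<le> \<theta> * u + (1 - \<theta>) * (n + \<theta> + 1)"
    using \<theta> u by (intro Youngs_inequality_0) auto
  \<comment> \<open>Expanding, \<open>(1 - \<theta>) * (n + \<theta> + 1) = n + 1 - \<theta> * n -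
    \<theta>^2\<close>, and the subtracted terms are nonnegative.\<close>
  also have "\<dots> \<le> u + (n + 1)"
  proof -
    have "\<theta> * u \<le> 1 * u" using \<theta> u by (intro mult_right_mono) auto
    moreover have "0 \<le> \<theta> * n" "0 \<le> \<theta> * \<theta>" using \<theta> by auto
    ultimately show ?thesis by (simp only: algebra_simps)
  qed
  finally have young: "u powr \<theta> * (n + \<theta> + 1) powr (1 - \<theta>) \<le> u + (n + 1)" .
  \<comment> \<open>After multiplication by \<open>(n + 1)!\<close> the two series terms become
    \<open>u^n * (u + n + 1)\<close>, whose second factor is the right side of
    \<open>young\<close>.\<close>
  have "u powr k * fact (Suc n) \<le> u powr k * (Gamma (k + 1) * (n + \<theta> + 1) powr (1 - \<theta>))"
    using fact_le_Gamma_times_powr[OF \<theta>, of n] unfolding k by (intro mult_left_mono) auto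
  also have "\<dots> = Gamma (k + 1) * u ^ n * (u powr \<theta> * (n + \<theta> + 1) powr (1 - \<theta>))"
    using u by (simp add: k powr_add powr_realpow)
  also have "\<dots> \<le> Gamma (k + 1) * u ^ n * (u + (n + 1))"
    using young G u by (intro mult_left_mono) auto
  also have "\<dots> = Gamma (k + 1) * (u ^ n / fact n + u ^ Suc n / fact (Suc n)) * fact (Suc n)"
  proof -
    have "u ^ n / fact n * fact (Suc n) = u ^ n * (n + 1)" by simp
    then have "(u ^ n / fact n + u ^ Suc n / fact (Suc n)) * fact (Suc n) = u ^ n * (u + (n + 1))"
      by (simp add: distrib_left distrib_right del: fact_Suc)
    then show ?thesis by (simp only: mult.assoc)
  qed
  finally have "u powr k \<le> Gamma (k + 1) * (u ^ n / fact n + u ^ Suc n / fact (Suc n))"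
    by (simp del: fact_Suc)
  also have "\<dots> \<le> Gamma (k + 1) * (exp u - 1 - u)"
    using two_exp_terms_le[OF assms(1) n] G by (intro mult_left_mono) auto
  finally show ?thesis .
qed (use assms in simp)

subsection \<open>Pairs of probability densities\<close>

lemma epowr_half_squared: "(epowr x (1 / 2))\<^sup>2 = x"
proof (cases x)
  case (real r)
  then have "(epowr x (1 / 2))\<^sup>2 = ennreal ((r powr (1 / 2))\<^sup>2)"
    by (simp add: epowr_def ennreal_power)
  then show ?thesis using real by (simp add: powr_half_sqrt)
qed (simp add: epowr_def)

lemma hellinger_squared:
  "(hellinger M p q)\<^sup>2 = (\<integral>\<^sup>+x. ennreal ((sqrt (p x) - sqrt (q x))\<^sup>2) \<partial>M)"
  by (simp add: hellinger_def epowr_half_squared)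

lemma bernstein_norm_squared:
  "(bernstein_norm P f)\<^sup>2 = 2 * (\<integral>\<^sup>+x. bernstein_fun \<bar>f x\<bar> \<partial>P)"
  by (simp add: bernstein_norm_def epowr_half_squared)

lemma ratio_eq: "0 \<le> p x \<Longrightarrow> 0 < q x \<Longrightarrow> ratio p q x = ennreal (p x / q x)"
  by (simp add: ratio_def divide_ennreal)

lemma ratio_zero: "0 < p x \<Longrightarrow> q x = 0 \<Longrightarrow> ratio p q x = \<infinity>"
  by (simp add: ratio_def)

lemma log_ratio_eq: "0 < p x \<Longrightarrow> 0 < q x \<Longrightarrow> log_ratio p q x = ereal (ln (p x / q x))"
  by (simp add: log_ratio_def ratio_eq elog_def)

lemma log_ratio_zero: "0 < p x \<Longrightarrow> q x = 0 \<Longrightarrow> log_ratio p q x = \<infinity>"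
  by (simp add: log_ratio_def ratio_zero elog_def)

locale density_pair =
  fixes M :: "'a measure" and p0 p :: "'a \<Rightarrow> real"
  assumes p0_measurable [measurable]: "p0 \<in> borel_measurable M"
    and p_measurable [measurable]: "p \<in> borel_measurable M"
    and p0_nonneg: "\<And>x. x \<in> space M \<Longrightarrow> 0 \<le> p0 x"
    and p_nonneg: "\<And>x. x \<in> space M \<Longrightarrow> 0 \<le> p x"
    and prob_p0: "prob_space (density M (\<lambda>x. ennreal (p0 x)))"
    and prob_p: "prob_space (density M (\<lambda>x. ennreal (p x)))"
begin

abbreviation P0 :: "'a measure" where "P0 \<equiv> density M (\<lambda>x. ennreal (p0 x))"

sublocale P0: prob_space P0 by (rule prob_p0)

definition root_ratio :: "'a \<Rightarrow> real" where "root_ratio x = sqrt (p x / p0 x)"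

text \<open>Real-valued stand-in for \<open>log_ratio p0 p\<close>; the two agree only where both
  densities are positive.\<close>

definition llr :: "'a \<Rightarrow> real" where "llr x = ln (p0 x / p x)"

text \<open>The squared Hellinger distance as a real number, open to Bochner integration; nothing is
  lost, because the integrand is always integrable.\<close>

definition hell_sq :: real where "hell_sq = (\<integral>x. (sqrt (p0 x) - sqrt (p x))\<^sup>2 \<partial>M)"

lemma root_ratio_measurable [measurable]: "root_ratio \<in> borel_measurable M"
  unfolding root_ratio_def by measurable

lemma llr_measurable [measurable]: "llr \<in> borel_measurable M"
  unfolding llr_def by measurable

lemma AE_p0_pos: "AE x in P0. x \<in> space M \<and> 0 < p0 x"
  by (subst AE_density) auto

lemma probability_density:
  assumes [measurable]: "q \<in> borel_measurable M" and "\<And>x. x \<in> space M \<Longrightarrow> 0 \<le> q x"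
    and "prob_space (density M (\<lambda>x. ennreal (q x)))"
  shows "integrable M q" "integral\<^sup>L M q = (1::real)"
proof -
  have "(\<integral>\<^sup>+x. ennreal (q x) \<partial>M) = emeasure (density M (\<lambda>x. ennreal (q x))) (space M)"
    by (subst emeasure_density) (auto intro!: nn_integral_cong)
  also have "\<dots> = 1"
    using prob_space.emeasure_space_1[OF assms(3)] by simp
  finally have *: "(\<integral>\<^sup>+x. ennreal (q x) \<partial>M) = ennreal 1" by simp
  have "AE x in M. 0 \<le> q x" using assms(2) by auto
  then show "integrable M q" "integral\<^sup>L M q = 1"
    using integrableI_nn_integral_finite[OF assms(1) _ *] integral_eq_nn_integral[OF assms(1)] *
    by auto
qed

lemmas p0_density = probability_density[OF p0_measurable p0_nonneg prob_p0]
lemmas p_density = probability_density[OF p_measurable p_nonneg prob_p]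

section \<open>The Hellinger integral\<close>

lemma root_mult_le_add: "x \<in> space M \<Longrightarrow> sqrt (p0 x * p x) \<le> p0 x + p x"
  using arith_geo_mean_sqrt[of "p0 x" "p x"] p0_nonneg[of x] p_nonneg[of x] by simp

lemma integrable_root_mult: "integrable M (\<lambda>x. sqrt (p0 x * p x))"
proof (rule Bochner_Integration.integrable_bound)
  show "integrable M (\<lambda>x. p0 x + p x)"
    using p0_density p_density by simp
  show "AE x in M. norm (sqrt (p0 x * p x)) \<le> norm (p0 x + p x)"
    using root_mult_le_add p0_nonneg p_nonneg by auto
qed simp

lemma hellinger_integrand:
  assumes "x \<in> space M"
  shows "(sqrt (p0 x) - sqrt (p x))\<^sup>2 = p0 x + p x - 2 * sqrt (p0 x * p x)"
  using p0_nonneg[OF assms] p_nonneg[OF assms] by (simp add: power2_diff real_sqrt_mult)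

lemma integrable_hellinger: "integrable M (\<lambda>x. (sqrt (p0 x) - sqrt (p x))\<^sup>2)"
proof (subst Bochner_Integration.integrable_cong[OF refl hellinger_integrand])
  show "integrable M (\<lambda>x. p0 x + p x - 2 * sqrt (p0 x * p x))"
    using p0_density p_density integrable_root_mult by simp
qed

text \<open>Both densities integrate to 1, so expanding the square leaves only the Hellinger
  affinity.\<close>

lemma hell_sq_eq: "hell_sq = 2 - 2 * (\<integral>x. sqrt (p0 x * p x) \<partial>M)"
proof -
  have "hell_sq = (\<integral>x. p0 x + p x - 2 * sqrt (p0 x * p x) \<partial>M)"
    unfolding hell_sq_def by (intro Bochner_Integration.integral_cong refl hellinger_integrand)
  then show ?thesis
    using p0_density p_density integrable_root_mult by simp
qed

lemma hell_sq_nonneg: "0 \<le> hell_sq"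
  unfolding hell_sq_def by simp

lemma hellinger_squared_eq: "(hellinger M p0 p)\<^sup>2 = ennreal hell_sq"
  unfolding hellinger_squared hell_sq_def
  by (rule nn_integral_eq_integral[OF integrable_hellinger]) simp

section \<open>Moments of the root ratio under \<open>P0\<close>\<close>

lemma p0_root_ratio: "x \<in> space M \<Longrightarrow> p0 x * root_ratio x = sqrt (p0 x * p x)"
  using p0_nonneg[of x] p_nonneg[of x]
  by (cases "p0 x = 0") (auto simp: root_ratio_def real_sqrt_divide real_sqrt_mult field_simps)

lemma integrable_root_ratio: "integrable P0 root_ratio"
  using integrable_root_mult p0_nonneg
  by (subst integrable_density) (auto simp: p0_root_ratio cong: Bochner_Integration.integrable_cong)

lemma integral_root_ratio: "(\<integral>x. root_ratio x \<partial>P0) = 1 - hell_sq / 2"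
proof -
  have "(\<integral>x. root_ratio x \<partial>P0) = (\<integral>x. sqrt (p0 x * p x) \<partial>M)"
    using p0_nonneg
    by (subst integral_density) (auto simp: p0_root_ratio cong: Bochner_Integration.integral_cong)
  then show ?thesis by (simp add: hell_sq_eq field_simps)
qed

text \<open>Where \<open>p0\<close> vanishes, the mass of \<open>p\<close> is lost. This is why the
  second moment of \<open>root_ratio\<close> is only bounded by 1, while the first moment is known
  exactly.\<close>

lemma p0_root_ratio_sq:
  assumes "x \<in> space M"
  shows "p0 x * (root_ratio x)\<^sup>2 = (if p0 x = 0 then 0 else p x)"
  using p0_nonneg[OF assms] p_nonneg[OF assms] by (simp add: root_ratio_def)

lemma integrable_p0_root_ratio_sq: "integrable M (\<lambda>x. p0 x * (root_ratio x)\<^sup>2)"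
  by (rule Bochner_Integration.integrable_bound[OF p_density(1)])
     (auto simp: p0_root_ratio_sq p_nonneg)

lemma integrable_root_ratio_sq: "integrable P0 (\<lambda>x. (root_ratio x)\<^sup>2)"
  using integrable_p0_root_ratio_sq p0_nonneg by (subst integrable_density) auto

lemma integral_root_ratio_sq: "(\<integral>x. (root_ratio x)\<^sup>2 \<partial>P0) \<le> 1"
proof -
  have "(\<integral>x. (root_ratio x)\<^sup>2 \<partial>P0) = (\<integral>x. p0 x * (root_ratio x)\<^sup>2 \<partial>M)"
    using p0_nonneg by (subst integral_density) auto
  also have "\<dots> \<le> (\<integral>x. p x \<partial>M)"
    using integrable_p0_root_ratio_sq p_density(1) p_nonneg
    by (intro integral_mono) (auto simp: p0_root_ratio_sq)
  finally show ?thesis using p_density by simp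
qed

lemma integrable_one_minus_root_ratio_sq: "integrable P0 (\<lambda>x. (1 - root_ratio x)\<^sup>2)"
  using integrable_root_ratio integrable_root_ratio_sq
  by (auto simp: power2_diff)

text \<open>Expanding the square, the second moment is at most 1 and the first is
  \<open>1 - hell_sq / 2\<close>, so the total is at most \<open>2 - 2 + hell_sq\<close>.\<close>

lemma integral_one_minus_root_ratio_sq: "(\<integral>x. (1 - root_ratio x)\<^sup>2 \<partial>P0) \<le> hell_sq"
proof -
  have "(\<integral>x. (1 - root_ratio x)\<^sup>2 \<partial>P0)
      = 1 + (\<integral>x. (root_ratio x)\<^sup>2 \<partial>P0) - 2 * (\<integral>x. root_ratio x \<partial>P0)"
    using integrable_root_ratio integrable_root_ratio_sq P0.prob_space
    by (simp add: power2_diff)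
  then show ?thesis
    using integral_root_ratio integral_root_ratio_sq by simp
qed

lemma nn_integral_one_minus_root_ratio_sq:
  "(\<integral>\<^sup>+x. ennreal ((1 - root_ratio x)\<^sup>2) \<partial>P0) \<le> ennreal hell_sq"
  using integral_one_minus_root_ratio_sq
  by (subst nn_integral_eq_integral[OF integrable_one_minus_root_ratio_sq]) (auto intro: ennreal_leI)

text \<open>The integrand dominates infinity times the indicator of a set of positive
  \<open>P0\<close>-measure. Points with \<open>p0 x = 0\<close> form a null set, so the second
  assumption may ignore them.\<close>

lemma nn_integral_infinite:
  assumes "\<not> (AE x in P0. 0 < p x)"
    and "\<And>x. x \<in> space M \<Longrightarrow> 0 < p0 x \<Longrightarrow> p x = 0 \<Longrightarrow> f x = \<infinity>"
  shows "(\<integral>\<^sup>+x. f x \<partial>P0) = \<infinity>"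
proof -
  define A where "A = {x \<in> space P0. \<not> 0 < p x}"
  have A: "A \<in> sets P0" unfolding A_def by measurable
  have "emeasure P0 A \<noteq> 0"
    using assms(1) A AE_iff_null[of P0 "\<lambda>x. 0 < p x"] by (auto simp: A_def null_sets_def)
  then have "\<infinity> = (\<integral>\<^sup>+x. \<infinity> * indicator A x \<partial>P0)"
    using A by (subst nn_integral_cmult_indicator) (auto simp: ennreal_top_mult)
  also have "\<dots> \<le> (\<integral>\<^sup>+x. f x \<partial>P0)"
  proof (rule nn_integral_mono_AE)
    show "AE x in P0. \<infinity> * indicator A x \<le> f x"
      using AE_p0_pos
    proof eventually_elim
      case (elim x)
      then show ?case
        using assms(2)[of x] p_nonneg[of x] by (auto simp: A_def indicator_def)
    qed
  qed
  finally show ?thesis by (simp add: top_unique)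
qed

section \<open>Pointwise bounds on the log-likelihood ratio\<close>

lemma llr_eq:
  assumes "0 < p0 x" "0 < p x"
  shows "0 < root_ratio x" "llr x = - (2 * ln (root_ratio x))"
  using assms by (auto simp: llr_def root_ratio_def ln_sqrt ln_div field_simps)

lemma ratio_gt_4_iff:
  assumes "0 < p0 x" "0 < p x"
  shows "4 < p0 x / p x \<longleftrightarrow> root_ratio x < 1 / 2"
proof -
  have "root_ratio x < 1 / 2 \<longleftrightarrow> sqrt (p x / p0 x) < sqrt (1 / 4)"
    by (simp add: root_ratio_def real_sqrt_divide)
  also have "\<dots> \<longleftrightarrow> 4 < p0 x / p x"
    unfolding real_sqrt_less_iff using assms by (simp add: field_simps)
  finally show ?thesis by simp
qed

text \<open>Division by zero gives 0, so this vanishes where \<open>p x = 0\<close>, whereas the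
  integrand of \<open>ratio_tail\<close> is infinite there if \<open>p0 x > 0\<close>. The two may
  be exchanged only when \<open>p\<close> is positive \<open>P0\<close>-almost everywhere.\<close>

definition tail_fun :: "real \<Rightarrow> 'a \<Rightarrow> real" where
  "tail_fun \<delta> x = (if 4 < p0 x / p x then (p0 x / p x) powr \<delta> else 0)"

lemma tail_fun_measurable [measurable]: "tail_fun \<delta> \<in> borel_measurable M"
  unfolding tail_fun_def by measurable

lemma tail_fun_nonneg: "0 \<le> tail_fun \<delta> x"
  by (simp add: tail_fun_def)

definition bernstein_llr :: "real \<Rightarrow> 'a \<Rightarrow> real" where
  "bernstein_llr \<delta> x = exp (\<delta> * \<bar>llr x\<bar>) - 1 - \<delta> * \<bar>llr x\<bar>"

lemma bernstein_llr_measurable [measurable]: "bernstein_llr \<delta> \<in> borel_measurable M"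
  unfolding bernstein_llr_def by measurable

lemma bernstein_llr_nonneg: "0 \<le> bernstein_llr \<delta> x"
  using exp_ge_add_one_self[of "\<delta> * \<bar>llr x\<bar>"] unfolding bernstein_llr_def by linarith

lemma bernstein_llr_lower:
  assumes "0 < p0 x" "0 < p x" "0 \<le> \<delta>"
  shows "(1 - 1 / 4 powr \<delta>)\<^sup>2 * tail_fun \<delta> x \<le> 2 * bernstein_llr \<delta> x"
proof (cases "4 < p0 x / p x")
  case True
  \<comment> \<open>Here \<open>t >= 4 powr \<delta>\<close>, as
    \<open>bernstein_fun_lower_bound\<close> requires, and \<open>llr x > 0\<close> removes the
    absolute value.\<close>
  define t where "t = (p0 x / p x) powr \<delta>"
  have l: "0 < llr x" using True unfolding llr_def by (intro ln_gt_zero) simp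
  have "t = exp (\<delta> * llr x)" using assms True by (simp add: t_def llr_def powr_def)
  then have "bernstein_llr \<delta> x = t - 1 - ln t" using l by (simp add: bernstein_llr_def)
  moreover have "(1 - 1 / 4 powr \<delta>)\<^sup>2 * t \<le> 2 * (t - 1 - ln t)"
    using assms True unfolding t_def
    by (intro bernstein_fun_lower_bound ge_one_powr_ge_zero powr_mono2) auto
  ultimately show ?thesis using True by (simp add: tail_fun_def t_def)
qed (simp add: tail_fun_def bernstein_llr_nonneg)

lemma bernstein_llr_upper:
  assumes "0 < p0 x" "0 < p x" "0 \<le> \<delta>" "\<delta> \<le> 1"
  shows "bernstein_llr \<delta> x \<le> 9 * \<delta> * (1 - root_ratio x)\<^sup>2 + tail_fun \<delta> x"
proof (cases "4 < p0 x / p x")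
  case True
  have l: "0 < llr x" using True unfolding llr_def by (intro ln_gt_zero) simp
  have "(p0 x / p x) powr \<delta> = exp (\<delta> * llr x)"
    using assms True by (simp add: llr_def powr_def)
  moreover have "0 \<le> \<delta> * llr x" using l assms by simp
  ultimately have "bernstein_llr \<delta> x \<le> tail_fun \<delta> x"
    using l True by (simp add: bernstein_llr_def tail_fun_def)
  moreover have "0 \<le> 9 * \<delta> * (1 - root_ratio x)\<^sup>2" using assms by simp
  ultimately show ?thesis by linarith
next
  case False
  have s: "1 / 2 \<le> root_ratio x" using ratio_gt_4_iff[of x] assms False by simp
  have l: "\<bar>llr x\<bar> = \<bar>2 * ln (root_ratio x)\<bar>" using llr_eq[OF assms(1,2)] by simp
  have "bernstein_llr \<delta> x \<le> \<delta> * (exp \<bar>llr x\<bar> - 1 - \<bar>llr x\<bar>)"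
    unfolding bernstein_llr_def using assms by (intro exp_scale_le) auto
  also have "\<dots> \<le> \<delta> * (9 * (1 - root_ratio x)\<^sup>2)"
    unfolding l using assms by (intro mult_left_mono exp_abs_two_ln_le s) auto
  finally show ?thesis using tail_fun_nonneg[of \<delta> x] by simp
qed

lemma llr_lower:
  assumes "0 < p0 x" "0 < p x"
  shows "2 * (1 - root_ratio x) \<le> llr x"
  using ln_le_minus_one[of "root_ratio x"] llr_eq[OF assms] by simp

lemma llr_upper:
  assumes "0 < p0 x" "0 < p x" "0 < \<delta>"
  shows "llr x \<le> 2 * (1 - root_ratio x) + 2 * (1 - root_ratio x)\<^sup>2 + tail_fun \<delta> x / \<delta>"
proof (cases "4 < p0 x / p x")
  case True
  have "\<delta> * llr x = ln ((p0 x / p x) powr \<delta>)"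
    using assms by (simp add: llr_def ln_powr)
  also have "\<dots> \<le> (p0 x / p x) powr \<delta>"
    using assms by (intro less_imp_le ln_less_self) simp
  finally have "llr x \<le> tail_fun \<delta> x / \<delta>"
    using True assms by (simp add: tail_fun_def field_simps)
  \<comment> \<open>Beyond the threshold \<open>root_ratio x < 1/2\<close>, so the linear term is
    positive as well, and the tail term alone suffices.\<close>
  moreover have "0 \<le> 2 * (1 - root_ratio x) + 2 * (1 - root_ratio x)\<^sup>2"
    using ratio_gt_4_iff[of x] assms True by simp
  ultimately show ?thesis by (rule add_increasing[rotated])
next
  case False
  have s: "1 / 2 \<le> root_ratio x" using ratio_gt_4_iff[of x] assms False by simp
  show ?thesis
    using minus_ln_le_quadratic[OF s] llr_eq[OF assms(1,2)] False by (simp add: tail_fun_def)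
qed

text \<open>The bound \<open>ln y <= y\<close> at \<open>y = p/p0\<close>, which is the integrable
  \<open>root_ratio\<close> squared. Hence the divergence is never a difference of two infinities;
  where \<open>p\<close> vanishes the negative part is 0.\<close>

lemma nn_integral_log_ratio_neg: "(\<integral>\<^sup>+x. e2ennreal (- log_ratio p0 p x) \<partial>P0) < \<infinity>"
proof -
  have "(\<integral>\<^sup>+x. e2ennreal (- log_ratio p0 p x) \<partial>P0) \<le> (\<integral>\<^sup>+x. ennreal ((root_ratio x)\<^sup>2) \<partial>P0)"
  proof (rule nn_integral_mono_AE)
    show "AE x in P0. e2ennreal (- log_ratio p0 p x) \<le> ennreal ((root_ratio x)\<^sup>2)"
      using AE_p0_pos
    proof eventually_elim
      case (elim x)
      show ?case
      proof (cases "p x = 0")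
        case False
        then have px: "0 < p x" using p_nonneg[of x] elim by simp
        have "- ln (p0 x / p x) = ln (p x / p0 x)" using px elim by (simp add: ln_div)
        also have "\<dots> \<le> p x / p0 x" using px elim by (intro less_imp_le ln_less_self) simp
        finally have "- ln (p0 x / p x) \<le> (root_ratio x)\<^sup>2"
          using px elim by (simp add: root_ratio_def)
        then show ?thesis using px elim by (simp add: log_ratio_eq ennreal_leI)
      qed (use elim in \<open>simp add: log_ratio_zero e2ennreal_neg\<close>)
    qed
  qed
  also have "\<dots> < \<infinity>"
    by (subst nn_integral_eq_integral[OF integrable_root_ratio_sq]) auto
  finally show ?thesis .
qed

section \<open>The case where \<open>p\<close> vanishes with positive
  \<open>P0\<close>-probability\<close>

lemma ratio_tail_infinite:
  assumes "\<not> (AE x in P0. 0 < p x)"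
  shows "ratio_tail \<delta> M p0 p = \<infinity>"
  unfolding ratio_tail_def
  by (rule nn_integral_infinite[OF assms]) (simp add: ratio_zero epowr_def less_top[symmetric])

lemma bernstein_infinite:
  assumes "\<not> (AE x in P0. 0 < p x)" "0 < \<delta>"
  shows "(bernstein_norm P0 (\<lambda>x. ereal \<delta> * log_ratio p0 p x))\<^sup>2 = \<infinity>"
proof -
  have "(\<integral>\<^sup>+x. bernstein_fun \<bar>ereal \<delta> * log_ratio p0 p x\<bar> \<partial>P0) = \<infinity>"
    using assms(2)
    by (intro nn_integral_infinite[OF assms(1)]) (simp add: log_ratio_zero bernstein_fun_def)
  then show ?thesis by (simp add: bernstein_norm_squared ennreal_mult_top)
qed

lemma KL_variation_infinite:
  assumes "\<not> (AE x in P0. 0 < p x)"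
  shows "KL_variation k M p0 p = \<infinity>"
  unfolding KL_variation_def
  by (rule nn_integral_infinite[OF assms]) (simp add: log_ratio_zero epowr_def)

lemma KL_infinite:
  assumes "(\<integral>\<^sup>+x. e2ennreal (log_ratio p0 p x) \<partial>P0) = \<infinity>"
  shows "KL M p0 p = \<infinity>"
  using nn_integral_log_ratio_neg unfolding KL_def expect_def assms
  by (cases "\<integral>\<^sup>+x. e2ennreal (- log_ratio p0 p x) \<partial>P0") auto

lemma KL_infinite_not_AE_pos:
  assumes "\<not> (AE x in P0. 0 < p x)"
  shows "KL M p0 p = \<infinity>"
  by (intro KL_infinite nn_integral_infinite[OF assms]) (simp add: log_ratio_zero)

section \<open>Reduction to real-valued integrands when \<open>p\<close> is positive almost
  everywhere\<close>

lemma AE_both_pos: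
  assumes "AE x in P0. 0 < p x"
  shows "AE x in P0. 0 < p0 x \<and> 0 < p x"
  using AE_p0_pos assms by eventually_elim simp

lemma ratio_tail_eq:
  assumes "AE x in P0. 0 < p x"
  shows "ratio_tail \<delta> M p0 p = (\<integral>\<^sup>+x. ennreal (tail_fun \<delta> x) \<partial>P0)"
  unfolding ratio_tail_def
proof (rule nn_integral_cong_AE)
  show "AE x in P0. epowr (ratio p0 p x) \<delta> * indicator {y. 4 < ratio p0 p y} x
      = ennreal (tail_fun \<delta> x)"
    using AE_both_pos[OF assms]
  proof eventually_elim
    case (elim x)
    have "4 < ennreal (p0 x / p x) \<longleftrightarrow> 4 < p0 x / p x"
      using elim by (subst ennreal_numeral[symmetric], subst ennreal_less_iff) auto
    then show ?case
      using elim by (auto simp: ratio_eq epowr_def tail_fun_def)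
  qed
qed

lemma bernstein_eq:
  assumes "AE x in P0. 0 < p x" "0 < \<delta>"
  shows "(bernstein_norm P0 (\<lambda>x. ereal \<delta> * log_ratio p0 p x))\<^sup>2
    = 2 * (\<integral>\<^sup>+x. ennreal (bernstein_llr \<delta> x) \<partial>P0)"
proof -
  have "AE x in P0. bernstein_fun \<bar>ereal \<delta> * log_ratio p0 p x\<bar> = ennreal (bernstein_llr \<delta> x)"
    using AE_both_pos[OF assms(1)]
    by eventually_elim
       (use assms(2) in \<open>simp add: log_ratio_eq bernstein_fun_def bernstein_llr_def llr_def abs_mult\<close>)
  then show ?thesis by (simp add: bernstein_norm_squared cong: nn_integral_cong_AE)
qed

lemma KL_variation_eq:
  assumes "AE x in P0. 0 < p x"
  shows "KL_variation k M p0 p = (\<integral>\<^sup>+x. ennreal (\<bar>llr x\<bar> powr k) \<partial>P0)"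
  unfolding KL_variation_def
  by (rule nn_integral_cong_AE, use AE_both_pos[OF assms] in eventually_elim)
     (simp add: log_ratio_eq llr_def epowr_def)

lemma nn_integral_log_ratio_eq:
  assumes "AE x in P0. 0 < p x"
  shows "(\<integral>\<^sup>+x. e2ennreal (log_ratio p0 p x) \<partial>P0) = (\<integral>\<^sup>+x. ennreal (llr x) \<partial>P0)"
    and "(\<integral>\<^sup>+x. e2ennreal (- log_ratio p0 p x) \<partial>P0) = (\<integral>\<^sup>+x. ennreal (- llr x) \<partial>P0)"
  by (rule nn_integral_cong_AE, use AE_both_pos[OF assms] in eventually_elim,
      simp add: log_ratio_eq llr_def)+

text \<open>The negative part always has a finite integral, so the positive part decides.\<close>

lemma integrable_llr_iff:
  assumes "AE x in P0. 0 < p x"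
  shows "integrable P0 llr \<longleftrightarrow> (\<integral>\<^sup>+x. ennreal (llr x) \<partial>P0) < \<infinity>"
  using nn_integral_log_ratio_neg unfolding nn_integral_log_ratio_eq[OF assms]
  by (auto simp: real_integrable_def less_top)

lemma KL_eq:
  assumes "AE x in P0. 0 < p x" "integrable P0 llr"
  shows "KL M p0 p = ereal (\<integral>x. llr x \<partial>P0)"
proof -
  have "(\<integral>\<^sup>+x. ennreal (llr x) \<partial>P0) \<noteq> \<infinity>" "(\<integral>\<^sup>+x. ennreal (- llr x) \<partial>P0) \<noteq> \<infinity>"
    using assms(2) by (auto simp: real_integrable_def)
  then show ?thesis
    unfolding KL_def expect_def nn_integral_log_ratio_eq[OF assms(1)]
      real_lebesgue_integral_def[OF assms(2)]
    by (cases "\<integral>\<^sup>+x. ennreal (llr x) \<partial>P0"; cases "\<integral>\<^sup>+x. ennreal (- llr x) \<partial>P0") auto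
qed

section \<open>The integrated inequalities\<close>

lemma bernstein_lower:
  assumes "0 < \<delta>"
  shows "ennreal ((1 - 1 / 4 powr \<delta>)\<^sup>2) * ratio_tail \<delta> M p0 p
    \<le> (bernstein_norm P0 (\<lambda>x. ereal \<delta> * log_ratio p0 p x))\<^sup>2"
proof (cases "AE x in P0. 0 < p x")
  case True
  have "ennreal ((1 - 1 / 4 powr \<delta>)\<^sup>2) * ratio_tail \<delta> M p0 p
      = (\<integral>\<^sup>+x. ennreal ((1 - 1 / 4 powr \<delta>)\<^sup>2 * tail_fun \<delta> x) \<partial>P0)"
    unfolding ratio_tail_eq[OF True]
    by (subst nn_integral_cmult[symmetric]) (auto simp: ennreal_mult tail_fun_nonneg)
  also have "\<dots> \<le> (\<integral>\<^sup>+x. ennreal (2 * bernstein_llr \<delta> x) \<partial>P0)"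
    by (rule nn_integral_mono_AE, use AE_both_pos[OF True] in eventually_elim)
       (use assms in \<open>auto intro!: ennreal_leI bernstein_llr_lower\<close>)
  also have "\<dots> = (bernstein_norm P0 (\<lambda>x. ereal \<delta> * log_ratio p0 p x))\<^sup>2"
    unfolding bernstein_eq[OF True assms]
    by (subst nn_integral_cmult[symmetric]) (auto simp: ennreal_mult bernstein_llr_nonneg)
  finally show ?thesis .
qed (simp add: bernstein_infinite assms)

lemma bernstein_upper:
  assumes "0 < \<delta>" "\<delta> \<le> 1"
  shows "(bernstein_norm P0 (\<lambda>x. ereal \<delta> * log_ratio p0 p x))\<^sup>2
    \<le> 18 * ennreal \<delta> * (hellinger M p0 p)\<^sup>2 + 2 * ratio_tail \<delta> M p0 p"
proof (cases "AE x in P0. 0 < p x")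
  case True
  have "(\<integral>\<^sup>+x. ennreal (bernstein_llr \<delta> x) \<partial>P0)
      \<le> (\<integral>\<^sup>+x. ennreal (9 * \<delta>) * ennreal ((1 - root_ratio x)\<^sup>2) + ennreal (tail_fun \<delta> x) \<partial>P0)"
  proof (rule nn_integral_mono_AE, use AE_both_pos[OF True] in eventually_elim)
    case (elim x)
    then have "ennreal (bernstein_llr \<delta> x) \<le> ennreal (9 * \<delta> * (1 - root_ratio x)\<^sup>2 + tail_fun \<delta> x)"
      using assms by (intro ennreal_leI bernstein_llr_upper) auto
    then show ?case
      using assms by (simp add: ennreal_mult ennreal_plus tail_fun_nonneg)
  qed
  also have "\<dots> = ennreal (9 * \<delta>) * (\<integral>\<^sup>+x. ennreal ((1 - root_ratio x)\<^sup>2) \<partial>P0)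
      + ratio_tail \<delta> M p0 p"
    unfolding ratio_tail_eq[OF True]
    by (subst nn_integral_add, simp, simp, subst nn_integral_cmult) auto
  also have "\<dots> \<le> ennreal (9 * \<delta>) * ennreal hell_sq + ratio_tail \<delta> M p0 p"
    by (intro add_mono mult_left_mono nn_integral_one_minus_root_ratio_sq) auto
  finally have "2 * (\<integral>\<^sup>+x. ennreal (bernstein_llr \<delta> x) \<partial>P0)
      \<le> 2 * (ennreal (9 * \<delta>) * ennreal hell_sq + ratio_tail \<delta> M p0 p)"
    by (rule mult_left_mono) simp
  also have "\<dots> = 18 * ennreal \<delta> * (hellinger M p0 p)\<^sup>2 + 2 * ratio_tail \<delta> M p0 p"
    using assms by (simp add: hellinger_squared_eq ennreal_mult distrib_left mult.assoc[symmetric])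
  finally show ?thesis unfolding bernstein_eq[OF True assms(1)] .
qed (simp add: ratio_tail_infinite ennreal_mult_top)

lemma KL_lower: "enn2ereal ((hellinger M p0 p)\<^sup>2) \<le> KL M p0 p"
proof (cases "(AE x in P0. 0 < p x) \<and> (\<integral>\<^sup>+x. e2ennreal (log_ratio p0 p x) \<partial>P0) < \<infinity>")
  case True
  then have int: "integrable P0 llr"
    using integrable_llr_iff nn_integral_log_ratio_eq by simp
  \<comment> \<open>The minorant of \<open>llr_lower\<close> integrates to the squared Hellinger
    distance exactly, by the first moment.\<close>
  have "hell_sq = (\<integral>x. 2 * (1 - root_ratio x) \<partial>P0)"
    using integrable_root_ratio integral_root_ratio P0.prob_space by simp
  also have "\<dots> \<le> (\<integral>x. llr x \<partial>P0)"
  proof (rule integral_mono_AE)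
    show "integrable P0 (\<lambda>x. 2 * (1 - root_ratio x))" using integrable_root_ratio by simp
    show "AE x in P0. 2 * (1 - root_ratio x) \<le> llr x"
      using AE_both_pos[OF conjunct1[OF True]] by eventually_elim (simp only: llr_lower)
  qed (rule int)
  finally show ?thesis
    using KL_eq[OF conjunct1[OF True] int] hell_sq_nonneg
    by (simp add: hellinger_squared_eq)
next
  case False
  then have "\<not> (AE x in P0. 0 < p x) \<or> (\<integral>\<^sup>+x. e2ennreal (log_ratio p0 p x) \<partial>P0) = \<infinity>"
    using top.not_eq_extremum unfolding infinity_ennreal_def by blast
  then have "KL M p0 p = \<infinity>"
    using KL_infinite KL_infinite_not_AE_pos by blast
  then show ?thesis by simp
qed

lemma KL_upper:
  assumes "0 < \<delta>"
  shows "KL M p0 p \<le> enn2ereal (3 * (hellinger M p0 p)\<^sup>2 + ennreal (1 / \<delta>) * ratio_tail \<delta> M p0 p)"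
\<comment> \<open>A finite tail already forces \<open>p > 0\<close> almost everywhere. It also makes
  the majorant \<open>g\<close> integrable, so that \<open>llr\<close> is integrable and the
  divergence is a Bochner integral.\<close>
proof (cases "ratio_tail \<delta> M p0 p = \<infinity>")
  case True
  then show ?thesis using assms by (simp add: ennreal_mult_top)
next
  case False
  then have pos: "AE x in P0. 0 < p x" using ratio_tail_infinite by blast
  have tail: "(\<integral>\<^sup>+x. ennreal (tail_fun \<delta> x) \<partial>P0) < \<infinity>"
    using False ratio_tail_eq[OF pos] by (simp add: less_top)
  have int_tail: "integrable P0 (tail_fun \<delta>)"
    using tail by (intro integrableI_bounded) (simp_all add: tail_fun_nonneg)
  define g where "g x = 2 * (1 - root_ratio x) + 2 * (1 - root_ratio x)\<^sup>2 + tail_fun \<delta> x / \<delta>" for x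
  have int_g: "integrable P0 g"
    unfolding g_def using int_tail integrable_root_ratio integrable_one_minus_root_ratio_sq by simp
  have le_g: "AE x in P0. llr x \<le> g x"
    using AE_both_pos[OF pos] unfolding g_def by eventually_elim (use assms in \<open>simp only: llr_upper\<close>)
  have "(\<integral>\<^sup>+x. ennreal (llr x) \<partial>P0) \<le> (\<integral>\<^sup>+x. ennreal (g x) \<partial>P0)"
    by (rule nn_integral_mono_AE, use le_g in eventually_elim) (rule ennreal_leI)
  also have "\<dots> < \<infinity>" using int_g by (simp add: real_integrable_def less_top)
  finally have int: "integrable P0 llr" using integrable_llr_iff[OF pos] by simp
  have "(\<integral>x. llr x \<partial>P0) \<le> (\<integral>x. g x \<partial>P0)"
    by (rule integral_mono_AE[OF int int_g le_g])
  also have "\<dots> = 2 - 2 * (\<integral>x. root_ratio x \<partial>P0) + 2 * (\<integral>x. (1 - root_ratio x)\<^sup>2 \<partial>P0)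
      + (\<integral>x. tail_fun \<delta> x \<partial>P0) / \<delta>"
    unfolding g_def
    using int_tail integrable_root_ratio integrable_one_minus_root_ratio_sq P0.prob_space
    by simp
  \<comment> \<open>The constant is 3 = 1 + 2: the linear part contributes \<open>hell_sq\<close>
    and the quadratic part at most twice that.\<close>
  also have "\<dots> \<le> 3 * hell_sq + (\<integral>x. tail_fun \<delta> x \<partial>P0) / \<delta>"
    using integral_root_ratio integral_one_minus_root_ratio_sq by simp
  finally have "ereal (\<integral>x. llr x \<partial>P0) \<le> ereal (3 * hell_sq + (\<integral>x. tail_fun \<delta> x \<partial>P0) / \<delta>)"
    by simp
  also have "\<dots> = enn2ereal (ennreal (3 * hell_sq + (\<integral>x. tail_fun \<delta> x \<partial>P0) / \<delta>))"
    using assms hell_sq_nonneg by (subst enn2ereal_ennreal) (auto simp: tail_fun_nonneg)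
  also have "ennreal (3 * hell_sq + (\<integral>x. tail_fun \<delta> x \<partial>P0) / \<delta>)
      = 3 * (hellinger M p0 p)\<^sup>2 + ennreal (1 / \<delta>) * ratio_tail \<delta> M p0 p"
    using assms hell_sq_nonneg nn_integral_eq_integral[OF int_tail]
    by (simp add: ratio_tail_eq[OF pos] hellinger_squared_eq tail_fun_nonneg ennreal_plus
        ennreal_mult[symmetric] ennreal_mult'')
  finally show ?thesis unfolding KL_eq[OF pos int] .
qed

lemma KL_variation_upper:
  assumes "0 < \<delta>" "2 \<le> k"
  shows "KL_variation k M p0 p
    \<le> ennreal (1 / 2 * Gamma (k + 1) * \<delta> powr (- k))
        * (bernstein_norm P0 (\<lambda>x. ereal \<delta> * log_ratio p0 p x))\<^sup>2"
proof -
  define c where "c = Gamma (k + 1) * \<delta> powr (- k)"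
  have c: "0 < c" using assms Gamma_real_pos[of "k + 1"] by (simp add: c_def)
  show ?thesis
  proof (cases "AE x in P0. 0 < p x")
    case True
    have bound: "\<bar>llr x\<bar> powr k \<le> c * bernstein_llr \<delta> x" for x
    proof -
      have "\<bar>llr x\<bar> powr k = \<delta> powr (- k) * (\<delta> * \<bar>llr x\<bar>) powr k"
        using assms by (simp add: powr_mult powr_minus)
      also have "\<dots> \<le> \<delta> powr (- k) * (Gamma (k + 1) * bernstein_llr \<delta> x)"
        unfolding bernstein_llr_def using assms by (intro mult_left_mono powr_le_Gamma_times_exp) auto
      finally show ?thesis by (simp add: c_def mult_ac)
    qed
    have "KL_variation k M p0 p \<le> (\<integral>\<^sup>+x. ennreal c * ennreal (bernstein_llr \<delta> x) \<partial>P0)"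
      unfolding KL_variation_eq[OF True] using c bound
      by (intro nn_integral_mono) (simp add: ennreal_mult[symmetric] bernstein_llr_nonneg ennreal_leI)
    \<comment> \<open>The factor 1/2 offsets the 2 in the squared Bernstein norm.\<close>
    also have "\<dots> = ennreal (1 / 2 * c) * (2 * (\<integral>\<^sup>+x. ennreal (bernstein_llr \<delta> x) \<partial>P0))"
    proof -
      have "ennreal c = ennreal (1 / 2 * c) * 2"
        using c by (subst ennreal_numeral[symmetric], subst ennreal_mult[symmetric]) auto
      then show ?thesis by (simp add: nn_integral_cmult mult.assoc)
    qed
    finally show ?thesis
      unfolding bernstein_eq[OF True assms(1)] c_def by (simp only: mult.assoc)
  next
    case False
    \<comment> \<open>Strict positivity matters, since zero times infinity is zero in
      \<open>ennreal\<close>.\<close>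
    have "0 < 1 / 2 * Gamma (k + 1) * \<delta> powr (- k)" using c unfolding c_def by simp
    then have "ennreal (1 / 2 * Gamma (k + 1) * \<delta> powr (- k)) \<noteq> 0"
      by (simp only: ennreal_eq_0_iff not_le)
    then show ?thesis
      unfolding bernstein_infinite[OF False assms(1)]
      by (simp only: infinity_ennreal_def ennreal_mult_top if_False top_greatest)
  qed
qed

text \<open>With \<open>m\<close> the mean of \<open>|llr|\<close>, one has
  \<open>|llr - K| <= |llr| + m\<close>. Then \<open>add_powr_le\<close> and Jensen's bound
  \<open>m powr k <= V\<close> give \<open>2 powr (k - 1) * (V + V) = 2 powr k * V\<close>.\<close>

lemma KL_variation_centered_le:
  assumes "1 \<le> k"
  shows "ennreal (2 powr (- k)) * KL_variation_centered k M p0 p \<le> KL_variation k M p0 p"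
proof (cases "KL_variation k M p0 p = \<infinity>")
  case False
  then have pos: "AE x in P0. 0 < p x" using KL_variation_infinite by blast
  have int_k: "integrable P0 (\<lambda>x. \<bar>llr x\<bar> powr k)"
    using False unfolding KL_variation_eq[OF pos]
    by (intro integrableI_bounded) (simp_all add: less_top)
  have abs_le: "\<bar>y\<bar> \<le> 1 + \<bar>y\<bar> powr k" for y :: real
    using powr_mono[of 1 k "\<bar>y\<bar>"] assms by (cases "1 \<le> \<bar>y\<bar>") (auto intro: order_trans[of _ 1])
  have int: "integrable P0 llr"
    by (rule Bochner_Integration.integrable_bound[where f = "\<lambda>x. 1 + \<bar>llr x\<bar> powr k"])
       (use int_k abs_le in auto)
  define K where "K = (\<integral>x. llr x \<partial>P0)"
  define m where "m = (\<integral>x. \<bar>llr x\<bar> \<partial>P0)"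
  define V where "V = (\<integral>x. \<bar>llr x\<bar> powr k \<partial>P0)"
  have V: "KL_variation k M p0 p = ennreal V"
    unfolding KL_variation_eq[OF pos] V_def by (rule nn_integral_eq_integral[OF int_k]) simp
  have V0: "0 \<le> V" by (simp add: V_def)
  have m0: "0 \<le> m" by (simp add: m_def)
  have Km: "\<bar>K\<bar> \<le> m" unfolding K_def m_def by (rule integral_abs_bound)
  have mV: "m powr k \<le> V"
  proof (cases "m = 0")
    case False
    \<comment> \<open>Jensen's inequality by integrating the tangent at \<open>m\<close>, whose
      linear term has mean zero. The tangent point must be positive, which is why
      \<open>m = 0\<close> is separate.\<close>
    have "m powr k = (\<integral>x. m powr k + k * m powr (k - 1) * (\<bar>llr x\<bar> - m) \<partial>P0)"
      using int P0.prob_space by (simp add: m_def[symmetric])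
    also have "\<dots> \<le> V"
      unfolding V_def using False m0 assms int int_k
      by (intro integral_mono powr_above_tangent) auto
    finally show ?thesis .
  qed (use V0 in simp)
  have bound: "\<bar>llr x - K\<bar> powr k \<le> 2 powr (k - 1) * (\<bar>llr x\<bar> powr k + m powr k)" for x
  proof -
    have "\<bar>llr x - K\<bar> powr k \<le> (\<bar>llr x\<bar> + m) powr k"
      using Km assms by (intro powr_mono2) auto
    also have "\<dots> \<le> 2 powr (k - 1) * (\<bar>llr x\<bar> powr k + m powr k)"
      using m0 assms by (intro add_powr_le) auto
    finally show ?thesis .
  qed
  have KL: "KL M p0 p = ereal K" unfolding K_def by (rule KL_eq[OF pos int])
  have "KL_variation_centered k M p0 p = (\<integral>\<^sup>+x. ennreal (\<bar>llr x - K\<bar> powr k) \<partial>P0)"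
    unfolding KL_variation_centered_def KL
    by (simp, rule nn_integral_cong_AE, use AE_both_pos[OF pos] in eventually_elim)
       (simp add: log_ratio_eq llr_def epowr_def)
  also have "\<dots> \<le> (\<integral>\<^sup>+x. ennreal (2 powr (k - 1) * (\<bar>llr x\<bar> powr k + m powr k)) \<partial>P0)"
    by (intro nn_integral_mono ennreal_leI bound)
  also have "\<dots> = ennreal (\<integral>x. 2 powr (k - 1) * (\<bar>llr x\<bar> powr k + m powr k) \<partial>P0)"
    using int_k by (intro nn_integral_eq_integral) auto
  also have "(\<integral>x. 2 powr (k - 1) * (\<bar>llr x\<bar> powr k + m powr k) \<partial>P0)
      = 2 powr (k - 1) * (V + m powr k)"
    using int_k P0.prob_space by (simp add: V_def)
  also have "ennreal \<dots> \<le> ennreal (2 powr k * V)"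
  proof (rule ennreal_leI)
    have "2 powr (k - 1) * (V + m powr k) \<le> 2 powr (k - 1) * (V + V)"
      using mV by (intro mult_left_mono) auto
    then show "2 powr (k - 1) * (V + m powr k) \<le> 2 powr k * V"
      by (simp add: powr_diff)
  qed
  finally have "ennreal (2 powr (- k)) * KL_variation_centered k M p0 p
      \<le> ennreal (2 powr (- k)) * ennreal (2 powr k * V)"
    by (rule mult_left_mono) simp
  also have "\<dots> = KL_variation k M p0 p"
    unfolding V using V0 by (simp add: ennreal_mult[symmetric] powr_minus)
  finally show ?thesis .
qed simp

end

theorem theorem1:
  fixes M P0 P :: "'a measure" and p0 p :: "'a \<Rightarrow> real" and \<delta> :: real
  assumes "sigma_finite_measure M"
    and "prob_space P0" and "prob_space P"
    and "p0 \<in> borel_measurable M" and "p \<in> borel_measurable M"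
    and "\<And>x. x \<in> space M \<Longrightarrow> 0 \<le> p0 x" and "\<And>x. x \<in> space M \<Longrightarrow> 0 \<le> p x"
    and "P0 = density M (\<lambda>x. ennreal (p0 x))" and "P = density M (\<lambda>x. ennreal (p x))"
    and "0 < \<delta>" and "\<delta> \<le> 1"
  shows "(ennreal ((1 - 1 / 4 powr \<delta>)\<^sup>2) * ratio_tail \<delta> M p0 p
            \<le> (bernstein_norm P0 (\<lambda>x. ereal \<delta> * log_ratio p0 p x))\<^sup>2
          \<and> (bernstein_norm P0 (\<lambda>x. ereal \<delta> * log_ratio p0 p x))\<^sup>2
            \<le> 18 * ennreal \<delta> * (hellinger M p0 p)\<^sup>2 + 2 * ratio_tail \<delta> M p0 p)
       \<and> (enn2ereal ((hellinger M p0 p)\<^sup>2) \<le> KL M p0 p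
          \<and> KL M p0 p \<le> enn2ereal (3 * (hellinger M p0 p)\<^sup>2 + ennreal (1 / \<delta>) * ratio_tail \<delta> M p0 p))
       \<and> (\<forall>k::real. k \<ge> 2 \<longrightarrow>
            ennreal (2 powr (- k)) * KL_variation_centered k M p0 p \<le> KL_variation k M p0 p
          \<and> KL_variation k M p0 p
            \<le> ennreal (1 / 2 * Gamma (k + 1) * \<delta> powr (- k))
                * (bernstein_norm P0 (\<lambda>x. ereal \<delta> * log_ratio p0 p x))\<^sup>2)"
proof -
  interpret density_pair M p0 p
    by (rule density_pair.intro)
       (use assms(2,3) in \<open>simp_all only: assms(4-9)\<close>)
  note P0_eq = \<open>P0 = density M (\<lambda>x. ennreal (p0 x))\<close>
  have "ennreal (2 powr (- k)) * KL_variation_centered k M p0 p \<le> KL_variation k M p0 p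
      \<and> KL_variation k M p0 p
        \<le> ennreal (1 / 2 * Gamma (k + 1) * \<delta> powr (- k))
            * (bernstein_norm P0 (\<lambda>x. ereal \<delta> * log_ratio p0 p x))\<^sup>2" if "2 \<le> k" for k
    unfolding P0_eq using that \<open>0 < \<delta>\<close>
    by (intro conjI KL_variation_centered_le KL_variation_upper) simp_all
  moreover note bernstein_lower[OF \<open>0 < \<delta>\<close>, folded P0_eq]
    bernstein_upper[OF \<open>0 < \<delta>\<close> \<open>\<delta> \<le> 1\<close>, folded P0_eq] KL_lower KL_upper[OF \<open>0 < \<delta>\<close>]
  ultimately show ?thesis by blast
qed

end
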